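(* There exist $n$-node undirected unweighted graphs $G$ with $|E(G)|=m$ edges such that for every exact hopset $H$ of $G$ of size $|H|=O(m)$, the hopbound of $G\cup H$ is $\Omega(n^{2/7})$. (Here, for every constant $C>0$ the graphs can be chosen so that this holds for all exact hopsets of size at most $Cm$, with the constant in $\Omega$ depending only on $C$.)
   Context: An exact hopset of $G$ is a set $H$ of additional edges $(u,v)$ between connected vertices, each given weight $\mathrm{dist}_G(u,v)$ (edges of $G$ have weight $1$). The (exact) hopbound of $G\cup H$ is the least $\beta$ such that for every pair $(s,t)$ of vertices connected in $G$ there is an $s$–$t$ path in $G\cup H$ with at most $\beta$ edges and weight exactly $\mathrm{dist}_G(s,t)$. *)

theory Defs
  imports Complex_Main "Graph_Theory.Graph_Theory"
begin

text \<open>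
  An undirected simple graph is a \<^locale>\<open>pair_graph\<close>: finite, loop-free, and with a symmetric
  arc relation. Every undirected edge is therefore represented by two opposite arcs, so the
  size of a symmetric arc relation is counted in unordered pairs.
\<close>

definition num_edges :: "'a rel \<Rightarrow> nat" where
  "num_edges R = card ((\<lambda>(u, v). {u, v}) ` R)"

definition gdist :: "'a pair_pre_digraph \<Rightarrow> 'a \<Rightarrow> 'a \<Rightarrow> real" where
  "gdist G u v = real_of_ereal (wf_digraph.\<mu> (with_proj G) (\<lambda>_. 1) u v)"

text \<open>
  The weights of the hopset edges are determined by \<open>G\<close> (see \<open>union_weight\<close>), so a hopset
  is just its symmetric relation. It is allowed to contain edges of \<open>G\<close>; these
  have weight 1 either way and leave \<open>G \<union> H\<close> unchanged.
\<close>

definition exact_hopset :: "'a pair_pre_digraph \<Rightarrow> 'a rel \<Rightarrow> bool" where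
  "exact_hopset G H \<longleftrightarrow> sym H \<and> (\<forall>(u, v) \<in> H. u \<noteq> v \<and> u \<rightarrow>\<^sup>*\<^bsub>with_proj G\<^esub> v)"

definition graph_union :: "'a pair_pre_digraph \<Rightarrow> 'a rel \<Rightarrow> 'a pair_pre_digraph" where
  "graph_union G H = \<lparr>pverts = pverts G, parcs = parcs G \<union> H\<rparr>"

definition union_weight :: "'a pair_pre_digraph \<Rightarrow> ('a \<times> 'a) weight_fun" where
  "union_weight G e = (if e \<in> parcs G then 1 else gdist G (fst e) (snd e))"

definition hops_suffice :: "'a pair_pre_digraph \<Rightarrow> 'a rel \<Rightarrow> nat \<Rightarrow> bool" where
  "hops_suffice G H \<beta> \<longleftrightarrow>
     (\<forall>s t. s \<rightarrow>\<^sup>*\<^bsub>with_proj G\<^esub> t \<longrightarrow>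
        (\<exists>p. pre_digraph.apath (with_proj (graph_union G H)) s p t \<and>
             length p \<le> \<beta> \<and>
             wf_digraph.awalk_cost (union_weight G) p = gdist G s t))"

definition hopbound :: "'a pair_pre_digraph \<Rightarrow> 'a rel \<Rightarrow> nat" where
  "hopbound G H = (LEAST \<beta>. hops_suffice G H \<beta>)"

text \<open>
  A shortest path of \<open>G\<close> itself is available in \<open>G \<union> H\<close>, so the minimum in \<open>hopbound\<close> is
  taken over a nonempty set.
\<close>

lemma wf_graph_union:
  assumes "pair_graph G" "exact_hopset G H"
  shows "pair_wf_digraph (graph_union G H)"
proof -
  interpret pair_graph G by fact
  show ?thesis
  proof
    fix e assume e: "e \<in> parcs (graph_union G H)"
    have "fst e \<in> pverts G \<and> snd e \<in> pverts G"
    proof (cases "e \<in> parcs G")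
      case True
      then show ?thesis by (simp add: arc_fst_in_verts arc_snd_in_verts)
    next
      case False
      then have "fst e \<rightarrow>\<^sup>*\<^bsub>with_proj G\<^esub> snd e"
        using e assms(2) by (auto simp: graph_union_def exact_hopset_def)
      then show ?thesis by (simp add: reachable_in_verts)
    qed
    then show "fst e \<in> pverts (graph_union G H)" "snd e \<in> pverts (graph_union G H)"
      by (simp_all add: graph_union_def)
  qed
qed

lemma hops_suffice_card:
  assumes "pair_graph G" "exact_hopset G H"
  shows "hops_suffice G H (card (pverts G))"
  unfolding hops_suffice_def
proof (intro allI impI)
  fix s t assume st: "s \<rightarrow>\<^sup>*\<^bsub>with_proj G\<^esub> t"
  interpret G: pair_graph G by fact
  interpret U: pair_wf_digraph "graph_union G H" by (rule wf_graph_union) fact+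
  obtain p where p: "G.apath s p t" "G.\<mu> (\<lambda>_. 1) s t = G.awalk_cost (\<lambda>_. 1) p"
    using G.min_cost_awalk[OF st, of "\<lambda>_. 1"] by auto
  have sub: "set p \<subseteq> parcs G"
    using p(1) by (auto simp: G.apath_def G.awalk_def)
  have "U.apath s p t"
    using p(1) unfolding G.apath_def G.awalk_def U.apath_def U.awalk_def
    by (auto simp: graph_union_def)
  moreover have "length p \<le> card (pverts G)"
    using p(1) by (rule G.length_apath)
  moreover have "U.awalk_cost (union_weight G) p = gdist G s t"
  proof -
    have "map (union_weight G) p = map (\<lambda>_. 1) p"
      using sub by (auto simp: union_weight_def)
    then have "U.awalk_cost (union_weight G) p = G.awalk_cost (\<lambda>_. 1) p"
      unfolding U.awalk_cost_def G.awalk_cost_def by (rule arg_cong)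
    then show ?thesis
      using p(2) by (simp add: gdist_def)
  qed
  ultimately show "\<exists>p. pre_digraph.apath (with_proj (graph_union G H)) s p t \<and>
      length p \<le> card (pverts G) \<and>
      wf_digraph.awalk_cost (union_weight G) p = gdist G s t"
    by blast
qed

end

(*
Take vertices (t, x, y) with t a time coordinate, and arcs that increase t by 1 or 2. At the times
t = 3k and t = 3k + 1 a path may either move in x and y or stay; at time 3k + 1 staying is one edge
shorter. A direction d = (p, p') in {0..<q}^2, with q = 2^K, has a potential that is 1-Lipschitz and
grows by exactly 1 along the arcs of the walk that moves at time 3k iff r k <= p and at
time 3k + 1 iff r k <= p'; so these walks are shortest paths and an exact path in G + H between
their ends uses only hops that lie on them. Since r is the bit reversal sequence, a hop of
duration D can serve only O(1 + q^2 / D^2) of the q^2 directions. This is much less than q^2 / D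
once D exceeds a constant depending on C, as long as D <= c q^2 with a small c. Double counting
the time covered by long hops then shows that O(m) hopset edges cannot shorten all paths of
duration l = c q^2 to o(l) hops. With x-range O(q l) and y-range O(l) there are n = O(q l^3) = O(q^7) vertices, so l is of order
n^(2/7).
*)
theory Submission
  imports Defs
begin

section \<open>Tight arcs of a potential and exact hopsets\<close>

text \<open>For a 1-Lipschitz \<open>\<phi>\<close> a walk of such arcs is a shortest path with
  \<open>\<phi>\<close> as its certificate, and every shortest path between the same ends uses only
  such arcs.\<close>

definition tight :: "'a pair_pre_digraph \<Rightarrow> ('a \<Rightarrow> real) \<Rightarrow> 'a rel" where
  "tight G \<phi> = {(u, v) \<in> parcs G. \<phi> v - \<phi> u = 1}"

lemma tight_iff: "(u, v) \<in> tight G \<phi> \<longleftrightarrow> (u, v) \<in> parcs G \<and> \<phi> v - \<phi> u = 1"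
  by (simp add: tight_def)

lemma sum_list_potential_diff:
  fixes \<phi> :: "'a \<Rightarrow> real"
  shows "pcas u p v \<Longrightarrow> (\<Sum>e\<leftarrow>p. \<phi> (snd e) - \<phi> (fst e)) = \<phi> v - \<phi> u"
  by (induction p arbitrary: u) auto

lemma potential_diff_le_weight:
  fixes \<phi> :: "'a \<Rightarrow> real" and w :: "'a \<times> 'a \<Rightarrow> real"
  assumes "pcas u p v" and w: "\<And>e. e \<in> set p \<Longrightarrow> \<phi> (snd e) - \<phi> (fst e) \<le> w e"
  shows "\<phi> v - \<phi> u \<le> sum_list (map w p)"
  using sum_list_mono[of p "\<lambda>e. \<phi> (snd e) - \<phi> (fst e)" w, OF w]
    sum_list_potential_diff[OF assms(1), of \<phi>] by simp

text \<open>Complementary slackness: the slacks of the entries of \<open>p\<close> are nonnegative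
  and telescope to 0, so each of them vanishes.\<close>

lemma potential_diff_eq_weight:
  fixes \<phi> :: "'a \<Rightarrow> real" and w :: "'a \<times> 'a \<Rightarrow> real"
  assumes "pcas u p v" and w: "\<And>e. e \<in> set p \<Longrightarrow> \<phi> (snd e) - \<phi> (fst e) \<le> w e"
    and eq: "sum_list (map w p) = \<phi> v - \<phi> u" and e: "e \<in> set p"
  shows "w e = \<phi> (snd e) - \<phi> (fst e)"
proof -
  let ?s = "\<lambda>e. w e - (\<phi> (snd e) - \<phi> (fst e))"
  have "sum_list (map ?s p) = 0"
    using eq sum_list_potential_diff[OF assms(1), of \<phi>] by (simp add: sum_list_subtractf)
  moreover have "\<And>x. x \<in> set (map ?s p) \<Longrightarrow> 0 \<le> x"
    using w by auto
  ultimately have "\<forall>x\<in>set (map ?s p). x = 0"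
    using sum_list_nonneg_eq_0_iff by blast
  then show ?thesis using e by auto
qed

lemma pcas_rtrancl:
  assumes "pcas u p v" "set p \<subseteq> R\<^sup>*"
  shows "(u, v) \<in> R\<^sup>*" "e \<in> set p \<Longrightarrow> (u, fst e) \<in> R\<^sup>*"
  using assms
proof (induction p arbitrary: u)
  case (Cons a p)
  {
    case 1
    then show ?case using Cons.IH(1)[of "snd a"] by (cases a) (auto intro: rtrancl_trans)
  next
    case 2
    then show ?case using Cons.IH(2)[of "snd a"] by (cases a) (auto intro: rtrancl_trans)
  }
qed auto

lemma awalk_cost_unit:
  fixes G :: "'a pair_pre_digraph" and p :: "('a \<times> 'a) list"
  assumes "pair_wf_digraph G"
  shows "wf_digraph.awalk_cost (\<lambda>_. 1) p = real (length p)"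
proof -
  interpret pair_wf_digraph G by fact
  show ?thesis by (simp add: awalk_cost_def sum_list_triv)
qed

section \<open>Shortest paths certified by a potential\<close>

context pair_graph
begin

lemma gdist_apath:
  assumes "u \<rightarrow>\<^sup>*\<^bsub>with_proj G\<^esub> v"
  obtains p where "apath u p v" "gdist G u v = real (length p)"
proof -
  obtain p where p: "apath u p v" "\<mu> (\<lambda>_. 1) u v = awalk_cost (\<lambda>_. 1) p"
    using min_cost_awalk[OF assms, of "\<lambda>_. 1"] by auto
  then have "gdist G u v = real (length p)"
    unfolding gdist_def by (simp add: awalk_cost_unit[OF pair_wf_digraph_axioms])
  with p show thesis using that by blast
qed

lemma gdist_le_length:
  assumes "awalk u p v"
  shows "gdist G u v \<le> real (length p)"
proof -
  have "u \<rightarrow>\<^sup>*\<^bsub>with_proj G\<^esub> v" using assms by (auto simp: reachable_awalk)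
  then obtain q where q: "\<mu> (\<lambda>_. 1) u v = awalk_cost (\<lambda>_. 1) q"
    using min_cost_awalk[of u v "\<lambda>_. 1"] by auto
  moreover have "\<mu> (\<lambda>_. 1) u v \<le> awalk_cost (\<lambda>_. 1) p"
    using assms by (rule min_cost_le_walk_cost)
  ultimately show ?thesis
    unfolding gdist_def by (simp add: awalk_cost_unit[OF pair_wf_digraph_axioms])
qed

lemma tight_rtrancl_awalk:
  assumes "(u, v) \<in> (tight G \<phi>)\<^sup>*" "u \<in> pverts G"
  shows "\<exists>p. awalk u p v \<and> real (length p) = \<phi> v - \<phi> u"
  using assms
proof (induction rule: rtrancl_induct)
  case base
  then show ?case by (intro exI[of _ "[]"]) (simp add: awalk_Nil_iff)
next
  case (step v w)
  then obtain p where p: "awalk u p v" "real (length p) = \<phi> v - \<phi> u" by blast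
  have vw: "(v, w) \<in> parcs G" "\<phi> w - \<phi> v = 1" using step by (auto simp: tight_def)
  then have "awalk v [(v, w)] w" by (auto simp: awalk_simps intro: in_arcsD2)
  with p(1) have "awalk u (p @ [(v, w)]) w" by (rule awalk_appendI)
  then show ?case using p(2) vw by (intro exI[of _ "p @ [(v, w)]"]) auto
qed

context
  fixes \<phi> :: "'a \<Rightarrow> real"
  assumes lipschitz: "\<And>u v. (u, v) \<in> parcs G \<Longrightarrow> \<phi> v - \<phi> u \<le> 1"
begin

lemma potential_le_gdist:
  assumes "u \<rightarrow>\<^sup>*\<^bsub>with_proj G\<^esub> v"
  shows "\<phi> v - \<phi> u \<le> gdist G u v"
proof -
  obtain p where p: "apath u p v" "gdist G u v = real (length p)"
    using gdist_apath[OF assms] .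
  then have c: "pcas u p v" and a: "set p \<subseteq> parcs G" by (auto simp: apath_def awalk_def)
  have "\<phi> v - \<phi> u \<le> (\<Sum>e\<leftarrow>p. 1)"
    by (rule potential_diff_le_weight[OF c]) (use a lipschitz in auto)
  then show ?thesis using p(2) by (simp add: sum_list_triv)
qed

lemma gdist_path_tight:
  assumes p: "apath u p v" "gdist G u v = real (length p)" and eq: "gdist G u v = \<phi> v - \<phi> u"
  shows "set p \<subseteq> tight G \<phi>"
proof -
  have c: "pcas u p v" and a: "set p \<subseteq> parcs G" using p(1) by (auto simp: apath_def awalk_def)
  have "1 = \<phi> (snd e) - \<phi> (fst e)" if "e \<in> set p" for e
    by (rule potential_diff_eq_weight[OF c, where w = "\<lambda>_. 1"])
      (use a lipschitz eq p(2) that in \<open>auto simp: sum_list_triv\<close>)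
  then show ?thesis
    using a by (fastforce simp: tight_def)
qed

text \<open>The potential difference is a lower bound for the distance. A shortest path attains it
  only if no arc has slack; conversely, a tight walk has exactly this length and gives the matching
  upper bound.\<close>

lemma gdist_eq_potential_iff:
  assumes "u \<rightarrow>\<^sup>*\<^bsub>with_proj G\<^esub> v"
  shows "gdist G u v = \<phi> v - \<phi> u \<longleftrightarrow> (u, v) \<in> (tight G \<phi>)\<^sup>*"
proof
  assume eq: "gdist G u v = \<phi> v - \<phi> u"
  obtain p where p: "apath u p v" "gdist G u v = real (length p)"
    using gdist_apath[OF assms] .
  then have "pcas u p v" by (auto simp: apath_def awalk_def)
  moreover have "set p \<subseteq> (tight G \<phi>)\<^sup>*"
    using gdist_path_tight[OF p eq] by blast
  ultimately show "(u, v) \<in> (tight G \<phi>)\<^sup>*" by (rule pcas_rtrancl(1))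
next
  assume "(u, v) \<in> (tight G \<phi>)\<^sup>*"
  moreover have "u \<in> pverts G" using assms by (rule reachable_in_verts)
  ultimately obtain p where "awalk u p v" "real (length p) = \<phi> v - \<phi> u"
    using tight_rtrancl_awalk by blast
  then show "gdist G u v = \<phi> v - \<phi> u"
    using gdist_le_length potential_le_gdist[OF assms] by fastforce
qed

text \<open>A hopset edge weighs a distance, hence at least its potential difference, just like an
  arc of \<open>G\<close>. An exact path leaves no slack on any hop, so a hop outside
  \<open>G\<close> joins two vertices of one tight walk.\<close>

lemma exact_hop_path_tight:
  assumes H: "exact_hopset G H" and st: "(s, t) \<in> (tight G \<phi>)\<^sup>*" "s \<in> pverts G"
    and p: "pre_digraph.apath (with_proj (graph_union G H)) s p t"
    and cost: "awalk_cost (union_weight G) p = gdist G s t"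
    and e: "e \<in> set p"
  shows "e \<in> tight G \<phi> \<or> e \<in> H \<and> e \<in> (tight G \<phi>)\<^sup>*" "(s, fst e) \<in> (tight G \<phi>)\<^sup>*"
proof -
  interpret U: pair_wf_digraph "graph_union G H"
    using pair_graph_axioms H by (rule wf_graph_union)
  have c: "pcas s p t" and a: "set p \<subseteq> parcs G \<union> H"
    using p unfolding U.apath_def U.awalk_def by (auto simp: graph_union_def)
  have reach: "s \<rightarrow>\<^sup>*\<^bsub>with_proj G\<^esub> t"
    using tight_rtrancl_awalk[OF st] by (auto simp: reachable_awalk)
  have hop: "fst e \<rightarrow>\<^sup>*\<^bsub>with_proj G\<^esub> snd e" if "e \<in> H" for e
    using H that by (auto simp: exact_hopset_def)
  have le: "\<phi> (snd e) - \<phi> (fst e) \<le> union_weight G e" if "e \<in> set p" for e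
  proof (cases "e \<in> parcs G")
    case True
    then show ?thesis using lipschitz[of "fst e" "snd e"] by (simp add: union_weight_def)
  next
    case False
    then have "e \<in> H" using that a by auto
    then show ?thesis using False potential_le_gdist[OF hop] by (simp add: union_weight_def)
  qed
  have eq: "sum_list (map (union_weight G) p) = \<phi> t - \<phi> s"
    using cost gdist_eq_potential_iff[OF reach] st by (simp add: awalk_cost_def)
  have *: "e \<in> tight G \<phi> \<or> e \<in> H \<and> e \<in> (tight G \<phi>)\<^sup>*" if "e \<in> set p" for e
  proof -
    have w: "union_weight G e = \<phi> (snd e) - \<phi> (fst e)"
      by (rule potential_diff_eq_weight[OF c le eq that])
    show ?thesis
    proof (cases "e \<in> parcs G")
      case True
      then show ?thesis using w by (cases e) (simp add: union_weight_def tight_iff)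
    next
      case False
      then have "e \<in> H" using that a by auto
      then show ?thesis
        using False w gdist_eq_potential_iff[OF hop] by (simp add: union_weight_def)
    qed
  qed
  show "e \<in> tight G \<phi> \<or> e \<in> H \<and> e \<in> (tight G \<phi>)\<^sup>*" by (rule *[OF e])
  have "set p \<subseteq> (tight G \<phi>)\<^sup>*" using * by auto
  from pcas_rtrancl(2)[OF c this e] show "(s, fst e) \<in> (tight G \<phi>)\<^sup>*" .
qed

end

text \<open>Any single shortest path from \<open>u\<close> to \<open>v\<close> is tight for both
  potentials at once. This forces directions that share a hop to share a whole walk below that
  hop.\<close>

lemma tight_rtrancl_Int:
  assumes \<phi>: "\<And>u v. (u, v) \<in> parcs G \<Longrightarrow> \<phi> v - \<phi> u \<le> 1"
    and \<psi>: "\<And>u v. (u, v) \<in> parcs G \<Longrightarrow> \<psi> v - \<psi> u \<le> 1"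
    and uv: "(u, v) \<in> (tight G \<phi>)\<^sup>*" "(u, v) \<in> (tight G \<psi>)\<^sup>*" "u \<in> pverts G"
  shows "(u, v) \<in> (tight G \<phi> \<inter> tight G \<psi>)\<^sup>*"
proof -
  obtain q where "awalk u q v"
    using tight_rtrancl_awalk[OF uv(1,3)] by blast
  then have reach: "u \<rightarrow>\<^sup>*\<^bsub>with_proj G\<^esub> v" by (auto simp: reachable_awalk)
  obtain p where p: "apath u p v" "gdist G u v = real (length p)"
    using gdist_apath[OF reach] .
  then have c: "pcas u p v" by (auto simp: apath_def awalk_def)
  have "set p \<subseteq> tight G \<phi>"
    using gdist_path_tight[where \<phi> = \<phi>, OF \<phi> p] gdist_eq_potential_iff[where \<phi> = \<phi>, OF \<phi> reach] uv(1) by blast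
  moreover have "set p \<subseteq> tight G \<psi>"
    using gdist_path_tight[where \<phi> = \<psi>, OF \<psi> p] gdist_eq_potential_iff[where \<phi> = \<psi>, OF \<psi> reach] uv(2) by blast
  ultimately show ?thesis by (intro pcas_rtrancl(1)[OF c]) auto
qed

end

text \<open>
  Double counting: each critical pair is joined by a path whose long hops
  cover at least half of the time from \<open>s\<close> to \<open>t\<close>, while a long hop lies on few critical paths.
\<close>

lemma exact_hopset_charging:
  fixes G :: "'a pair_pre_digraph" and \<phi> :: "'d \<Rightarrow> 'a \<Rightarrow> real" and \<tau> :: "'a \<Rightarrow> nat"
    and P :: "('a \<times> 'a \<times> 'd) set" and \<Lambda> L B :: real
  assumes "pair_graph G"
    and lipschitz: "\<And>d u v. d \<in> D \<Longrightarrow> (u, v) \<in> parcs G \<Longrightarrow> \<phi> d v - \<phi> d u \<le> 1"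
    and time: "\<And>d u v. d \<in> D \<Longrightarrow> (u, v) \<in> tight G (\<phi> d) \<Longrightarrow> real (\<tau> v) - real (\<tau> u) < L"
    and "L > 0" "0 \<le> B" "finite D" "finite P"
    and critical: "\<And>s t d. (s, t, d) \<in> P \<Longrightarrow>
      d \<in> D \<and> s \<in> pverts G \<and> (s, t) \<in> (tight G (\<phi> d))\<^sup>* \<and> real (\<tau> t) - real (\<tau> s) = \<Lambda>"
    and disjoint: "\<And>s t s' t' d u. (s, t, d) \<in> P \<Longrightarrow> (s', t', d) \<in> P \<Longrightarrow>
      (s, u) \<in> (tight G (\<phi> d))\<^sup>* \<Longrightarrow> (s', u) \<in> (tight G (\<phi> d))\<^sup>* \<Longrightarrow> s = s' \<and> t = t'"
    and few: "\<And>u v. L \<le> real (\<tau> v) - real (\<tau> u) \<Longrightarrow>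
      (real (\<tau> v) - real (\<tau> u)) * real (card {d \<in> D. (u, v) \<in> (tight G (\<phi> d))\<^sup>*}) \<le> B"
    and H: "exact_hopset G H" and hops: "hops_suffice G H \<beta>"
    and short: "real \<beta> * L \<le> \<Lambda> / 2"
  shows "real (card P) * \<Lambda> \<le> 2 * B * real (num_edges H)"
proof -
  interpret pair_graph G by fact
  interpret U: pair_wf_digraph "graph_union G H"
    using pair_graph_axioms H by (rule wf_graph_union)
  define len where "len e = real (\<tau> (snd e)) - real (\<tau> (fst e))" for e
  define F where "F = {e \<in> H. L \<le> len e}"
  have "H \<subseteq> pverts G \<times> pverts G"
    using H by (auto simp: exact_hopset_def reachable_in_verts)
  then have "finite H"
    using pair_finite_verts by (meson finite_SigmaI finite_subset)
  then have "finite F" by (simp add: F_def)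
  \<comment> \<open>Long hops strictly advance in time, so at most one of the two orientations of an
    edge of \<open>H\<close> lies in \<open>F\<close>.\<close>
  have "inj_on (\<lambda>(u, v). {u, v}) F"
    using \<open>L > 0\<close> by (auto simp: inj_on_def F_def len_def doubleton_eq_iff)
  then have "card F = card ((\<lambda>(u, v). {u, v}) ` F)" by (simp add: card_image)
  also have "\<dots> \<le> num_edges H"
    unfolding num_edges_def using \<open>finite H\<close> by (intro card_mono) (auto simp: F_def)
  finally have card_F: "card F \<le> num_edges H" .
  have "\<exists>p. U.apath s p t \<and> length p \<le> \<beta> \<and> awalk_cost (union_weight G) p = gdist G s t"
    if z: "(s, t, d) \<in> P" for s t d
  proof -
    obtain q where "awalk s q t"
      using critical[OF z] tight_rtrancl_awalk[of s t "\<phi> d"] by blast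
    then have "s \<rightarrow>\<^sup>*\<^bsub>with_proj G\<^esub> t" by (auto simp: reachable_awalk)
    with hops show ?thesis by (simp add: hops_suffice_def)
  qed
  then have "\<exists>path. \<forall>s t d. (s, t, d) \<in> P \<longrightarrow> U.apath s (path (s, t, d)) t \<and>
      length (path (s, t, d)) \<le> \<beta> \<and> awalk_cost (union_weight G) (path (s, t, d)) = gdist G s t"
    by (intro exI[of _ "\<lambda>(s, t, d). SOME p. U.apath s p t \<and> length p \<le> \<beta> \<and>
      awalk_cost (union_weight G) p = gdist G s t"] allI impI) (simp, rule someI_ex)
  then obtain path where path: "\<And>s t d. (s, t, d) \<in> P \<Longrightarrow> U.apath s (path (s, t, d)) t"
      "\<And>s t d. (s, t, d) \<in> P \<Longrightarrow> length (path (s, t, d)) \<le> \<beta>"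
      "\<And>s t d. (s, t, d) \<in> P \<Longrightarrow> awalk_cost (union_weight G) (path (s, t, d)) = gdist G s t"
    by blast
  have hop: "e \<in> tight G (\<phi> d) \<or> e \<in> H \<and> e \<in> (tight G (\<phi> d))\<^sup>*" "(s, fst e) \<in> (tight G (\<phi> d))\<^sup>*"
    if z: "(s, t, d) \<in> P" and e: "e \<in> set (path (s, t, d))" for s t d e
  proof -
    have c: "d \<in> D" "s \<in> pverts G" "(s, t) \<in> (tight G (\<phi> d))\<^sup>*" using critical[OF z] by auto
    note * = exact_hop_path_tight[OF lipschitz[OF c(1)] H c(3) c(2) path(1)[OF z] path(3)[OF z] e]
    show "e \<in> tight G (\<phi> d) \<or> e \<in> H \<and> e \<in> (tight G (\<phi> d))\<^sup>*" "(s, fst e) \<in> (tight G (\<phi> d))\<^sup>*"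
      using * by blast+
  qed
  have long: "\<Lambda> / 2 \<le> (\<Sum>e\<in>F. if e \<in> set (path z) then len e else 0)" if z: "z \<in> P" for z
  proof -
    obtain s t d where [simp]: "z = (s, t, d)" by (cases z)
    let ?p = "path z"
    have ap: "U.apath s ?p t" "length ?p \<le> \<beta>" using path(1,2)[of s t d] z by auto
    then have c: "pcas s ?p t" and "distinct ?p"
      using U.distinct_verts_imp_distinct by (auto simp: U.apath_def U.awalk_def)
    have crit: "d \<in> D" "real (\<tau> t) - real (\<tau> s) = \<Lambda>" using critical z by auto
    \<comment> \<open>The hops outside \<open>F\<close> are tight arcs or short hopset edges. At
      most \<open>\<beta>\<close> of them occur, so they cover at most half of
      \<open>\<Lambda>\<close>, and the hops in \<open>F\<close> must cover the rest.\<close>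
    have "len e \<le> L" if "e \<in> set ?p - F" for e
    proof (cases "e \<in> tight G (\<phi> d)")
      case True
      then show ?thesis using time[OF crit(1), of "fst e" "snd e"] by (simp add: len_def)
    next
      case False
      then show ?thesis using hop(1)[of s t d e] z that by (auto simp: F_def)
    qed
    then have "(\<Sum>e\<in>set ?p - F. len e) \<le> (\<Sum>e\<in>set ?p - F. L)"
      by (rule sum_mono)
    also have "\<dots> = real (card (set ?p - F)) * L" by simp
    also have "\<dots> \<le> real \<beta> * L"
    proof -
      have "card (set ?p - F) \<le> card (set ?p)" by (simp add: card_mono)
      also have "\<dots> \<le> \<beta>" using card_length ap(2) by (rule order_trans)
      finally show ?thesis using \<open>L > 0\<close> by (intro mult_right_mono) auto
    qed
    finally have "(\<Sum>e\<in>set ?p - F. len e) \<le> \<Lambda> / 2" using short by linarith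
    moreover have "(\<Sum>e\<in>set ?p. len e) = \<Lambda>"
      using sum_list_potential_diff[OF c, of "\<lambda>u. real (\<tau> u)"] \<open>distinct ?p\<close> crit(2)
      by (simp add: len_def sum_list_distinct_conv_sum_set)
    moreover have "(\<Sum>e\<in>set ?p. len e) = (\<Sum>e\<in>set ?p - F. len e) + (\<Sum>e\<in>set ?p \<inter> F. len e)"
      by (subst sum.union_disjoint[symmetric]) (auto intro!: sum.cong)
    moreover have "(\<Sum>e\<in>set ?p \<inter> F. len e) = (\<Sum>e\<in>F. if e \<in> set ?p then len e else 0)"
      using sum.inter_restrict[OF \<open>finite F\<close>, of len "set ?p"] by (simp add: Int_commute)
    ultimately show ?thesis by linarith
  qed
  have "real (card P) * \<Lambda> = 2 * (\<Sum>z\<in>P. \<Lambda> / 2)" by simp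
  also have "\<dots> \<le> 2 * (\<Sum>z\<in>P. \<Sum>e\<in>F. if e \<in> set (path z) then len e else 0)"
    using long by (intro mult_left_mono sum_mono) auto
  also have "\<dots> = 2 * (\<Sum>e\<in>F. \<Sum>z\<in>P. if e \<in> set (path z) then len e else 0)"
    by (subst sum.swap) simp
  also have "\<dots> \<le> 2 * (\<Sum>e\<in>F. B)"
  proof (intro mult_left_mono sum_mono)
    fix e assume e: "e \<in> F"
    let ?Q = "{z \<in> P. e \<in> set (path z)}" and ?D = "{d \<in> D. (fst e, snd e) \<in> (tight G (\<phi> d))\<^sup>*}"
    \<comment> \<open>By \<open>disjoint\<close>, the start of the hop \<open>e\<close> lies on at
      most one critical walk of each direction. So the paths that use \<open>e\<close> are no more
      numerous than the directions that \<open>e\<close> can serve.\<close>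
    have "inj_on (\<lambda>z. snd (snd z)) ?Q"
    proof (rule inj_onI)
      fix z z' assume z: "z \<in> ?Q" "z' \<in> ?Q" "snd (snd z) = snd (snd z')"
      obtain s t d s' t' where "z = (s, t, d)" "z' = (s', t', d)"
        using z(3) by (cases z, cases z') auto
      then show "z = z'"
        using disjoint[of s t d s' t' "fst e"] hop(2)[of s t d e] hop(2)[of s' t' d e] z by auto
    qed
    moreover have "(\<lambda>z. snd (snd z)) ` ?Q \<subseteq> ?D"
    proof (rule image_subsetI)
      fix z assume z: "z \<in> ?Q"
      obtain s t d where [simp]: "z = (s, t, d)" by (cases z)
      show "snd (snd z) \<in> ?D"
        using hop(1)[of s t d e] critical[of s t d] z by auto
    qed
    ultimately have "card ?Q \<le> card ?D"
      using \<open>finite D\<close> by (intro card_inj_on_le) auto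
    moreover have "0 \<le> len e" using e \<open>L > 0\<close> by (auto simp: F_def)
    ultimately have "len e * real (card ?Q) \<le> len e * real (card ?D)"
      by (intro mult_left_mono) auto
    also have "\<dots> \<le> B" using few[where u = "fst e" and v = "snd e"] e by (auto simp: F_def len_def)
    finally have "len e * real (card ?Q) \<le> B" .
    moreover have "(\<Sum>z\<in>P. if e \<in> set (path z) then len e else 0) = len e * real (card ?Q)"
      using \<open>finite P\<close> by (simp add: sum.If_cases Int_def)
    ultimately show "(\<Sum>z\<in>P. if e \<in> set (path z) then len e else 0) \<le> B" by simp
  qed auto
  also have "\<dots> = 2 * B * real (card F)" by simp
  also have "\<dots> \<le> 2 * B * real (num_edges H)"
    using card_F \<open>0 \<le> B\<close> by (intro mult_left_mono) auto
  finally show ?thesis .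
qed

section \<open>Bit reversal\<close>

fun bitrev :: "nat \<Rightarrow> nat \<Rightarrow> nat" where
  "bitrev 0 k = 0"
| "bitrev (Suc K) k = (k mod 2) * 2 ^ K + bitrev K (k div 2)"

lemma bitrev_less: "bitrev K k < 2 ^ K"
proof (induction K arbitrary: k)
  case (Suc K)
  have "k mod 2 = 0 \<or> k mod 2 = 1" by linarith
  then show ?case using Suc[of "k div 2"] by auto
qed simp

text \<open>The top \<open>j\<close> bits of \<open>bitrev K i\<close> are the low \<open>j\<close>
  bits of \<open>i\<close> in reverse, and \<open>2 ^ j\<close> consecutive indices run through all
  residues modulo \<open>2 ^ j\<close>. Hence every window of this length meets every dyadic block
  of length \<open>2 ^ (K - j)\<close>.\<close>

lemma bitrev_equidistributed:
  assumes "j \<le> K" "t < 2 ^ K"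
  shows "\<exists>i. m \<le> i \<and> i < m + 2 ^ j \<and> bitrev K i div 2 ^ (K - j) = t div 2 ^ (K - j)"
  using assms
proof (induction K arbitrary: j t m)
  case (Suc K)
  show ?case
  proof (cases j)
    case 0
    then show ?thesis
      using Suc.prems bitrev_less[of "Suc K" m] by (intro exI[of _ m]) (simp del: bitrev.simps)
  next
    case (Suc j')
    define b where "b = t div 2 ^ K"
    have b: "b < 2"
      using \<open>t < 2 ^ Suc K\<close> unfolding b_def by (subst less_mult_imp_div_less) (auto simp: mult.commute)
    have t: "t = b * 2 ^ K + t mod 2 ^ K" unfolding b_def by (rule div_mult_mod_eq[symmetric])
    have "j' \<le> K" "t mod 2 ^ K < 2 ^ K" using Suc.prems Suc by auto
    \<comment> \<open>The prescribed top bit \<open>b\<close> fixes the parity of the index. The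
      least \<open>i\<close> with \<open>m \<le> 2 * i + b\<close> is
      \<open>(m + 1 - b) div 2\<close>, where the window of half the length starts.\<close>
    from Suc.IH[OF this, of "(m + 1 - b) div 2"]
    obtain i where i: "(m + 1 - b) div 2 \<le> i" "i < (m + 1 - b) div 2 + 2 ^ j'"
      "bitrev K i div 2 ^ (K - j') = (t mod 2 ^ K) div 2 ^ (K - j')" by blast
    have *: "(b * 2 ^ K + x) div 2 ^ (K - j') = b * 2 ^ j' + x div 2 ^ (K - j')" for x :: nat
    proof -
      have "b * 2 ^ K = (b * 2 ^ j') * 2 ^ (K - j')"
        using \<open>j' \<le> K\<close> by (simp flip: power_add)
      then show ?thesis by (simp only: div_mult_self3 power_not_zero zero_neq_numeral[symmetric] not_False_eq_True)
    qed
    have "bitrev (Suc K) (2 * i + b) = b * 2 ^ K + bitrev K i"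
      using b by simp
    then have "bitrev (Suc K) (2 * i + b) div 2 ^ (K - j') = t div 2 ^ (K - j')"
      using i(3) by (subst t) (simp add: *)
    moreover have "m \<le> 2 * i + b" using i(1) b by linarith
    moreover have "2 * i + b < m + 2 * 2 ^ j'" using i(2) b by linarith
    ultimately show ?thesis using Suc by (intro exI[of _ "2 * i + b"]) simp
  qed
qed auto

text \<open>Otherwise \<open>A\<close> reaches beyond two consecutive dyadic blocks. The second
  block then lies strictly between the minimum of \<open>A\<close> and another element, and a
  bit-reversed value from the window falls into it and separates the two.\<close>

lemma card_bitrev_indistinguishable:
  assumes "j \<le> K" "A \<subseteq> {..<2 ^ K}"
    and agree: "\<And>p p' i. p \<in> A \<Longrightarrow> p' \<in> A \<Longrightarrow> m \<le> i \<Longrightarrow> i < m + 2 ^ j \<Longrightarrow>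
      bitrev K i \<le> p \<longleftrightarrow> bitrev K i \<le> p'"
  shows "card A \<le> 2 * 2 ^ (K - j)"
proof (cases "A = {}")
  case False
  have fin: "finite A" using assms(2) finite_subset by blast
  let ?c = "2 ^ (K - j) :: nat"
  define a where "a = Min A"
  have a: "a \<in> A" "\<And>p. p \<in> A \<Longrightarrow> a \<le> p" using fin False by (auto simp: a_def)
  have "A \<subseteq> {a div ?c * ?c..<a div ?c * ?c + 2 * ?c}"
  proof
    fix p assume p: "p \<in> A"
    have "p div ?c \<le> a div ?c + 1"
    proof (rule ccontr)
      assume "\<not> p div ?c \<le> a div ?c + 1"
      then have "(a div ?c + 2) * ?c \<le> (p div ?c) * ?c" by (intro mult_le_mono1) simp
      also have "\<dots> \<le> p" by (rule div_times_less_eq_dividend)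
      finally have gt: "(a div ?c + 1) * ?c + ?c \<le> p" by simp
      then have "(a div ?c + 1) * ?c < 2 ^ K"
        using p assms(2) by force
      from bitrev_equidistributed[OF \<open>j \<le> K\<close> this, of m]
      obtain i where i: "m \<le> i" "i < m + 2 ^ j" "bitrev K i div ?c = a div ?c + 1"
        by auto
      have "a < bitrev K i"
        by (rule ccontr) (use div_le_mono[of "bitrev K i" a ?c] i(3) in auto)
      moreover have "bitrev K i \<le> p"
      proof -
        have "bitrev K i = (a div ?c + 1) * ?c + bitrev K i mod ?c"
          using div_mult_mod_eq[of "bitrev K i" ?c] i(3) by simp
        moreover have "bitrev K i mod ?c < ?c" by simp
        ultimately show ?thesis using gt by linarith
      qed
      ultimately show False using agree[OF p a(1) i(1,2)] by simp
    qed
    then have "p < a div ?c * ?c + 2 * ?c"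
    proof -
      assume "p div ?c \<le> a div ?c + 1"
      then have "(p div ?c) * ?c \<le> (a div ?c + 1) * ?c" by (rule mult_le_mono1)
      then have "(p div ?c) * ?c \<le> a div ?c * ?c + ?c" by simp
      moreover have "p mod ?c < ?c" by simp
      ultimately show ?thesis using div_mult_mod_eq[of p ?c] by linarith
    qed
    moreover have "a div ?c * ?c \<le> p" using a(2)[OF p] by (meson div_times_less_eq_dividend order_trans)
    ultimately show "p \<in> {a div ?c * ?c..<a div ?c * ?c + 2 * ?c}" by simp
  qed
  then have "card A \<le> card {a div ?c * ?c..<a div ?c * ?c + 2 * ?c}" by (rule card_mono[rotated]) simp
  then show ?thesis by simp
qed simp

section \<open>Moves in the grid\<close>

type_synonym point = "nat \<times> nat \<times> nat"

text \<open>The offset \<open>2 * 2 ^ K\<close> makes \<open>unit_cost\<close> larger than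
  \<open>2 ^ K\<close>, and thus larger than every \<open>gain\<close> in absolute value; without it
  the unit cost could be zero or negative.\<close>

definition shift :: "nat \<Rightarrow> nat \<Rightarrow> nat" where
  "shift K t = (if t mod 3 = 0 then 2 * 2 ^ K else 0) + bitrev K (t div 3)"

text \<open>A period of three time units takes two arcs, or three if the move at its second time is
  made. The move at the first time costs no extra arc. Weighing the first kind of move against
  displacement and the second against length yields two independent thresholds.\<close>

inductive grid_arc :: "nat \<Rightarrow> point \<Rightarrow> point \<Rightarrow> bool" for K where
  stay: "t mod 3 \<noteq> 1 \<Longrightarrow> grid_arc K (t, x, y) (t + 1, x, y)"
| skip: "t mod 3 = 1 \<Longrightarrow> grid_arc K (t, x, y) (t + 2, x, y)"
| step: "t mod 3 \<noteq> 2 \<Longrightarrow> grid_arc K (t, x, y) (t + 1, x + shift K t, y + 1)"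

definition steps :: "nat \<Rightarrow> nat \<times> nat \<Rightarrow> nat \<Rightarrow> bool" where
  "steps K d t \<longleftrightarrow> t mod 3 \<noteq> 2 \<and> bitrev K (t div 3) \<le> (if t mod 3 = 0 then fst d else snd d)"

definition next_point :: "nat \<Rightarrow> nat \<times> nat \<Rightarrow> point \<Rightarrow> point" where
  "next_point K d = (\<lambda>(t, x, y).
     if steps K d t then (t + 1, x + shift K t, y + 1)
     else if t mod 3 = 1 then (t + 2, x, y) else (t + 1, x, y))"

text \<open>The advantage of moving over staying in the scaled potential. The summand 1/2 excludes
  ties and makes moving preferable when the threshold is attained.\<close>

definition gain :: "nat \<Rightarrow> nat \<times> nat \<Rightarrow> nat \<Rightarrow> real" where
  "gain K d t = real (if t mod 3 = 0 then fst d else snd d) + 1 / 2 - real (bitrev K (t div 3))"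

definition unit_cost :: "nat \<Rightarrow> nat \<times> nat \<Rightarrow> real" where
  "unit_cost K d = 2 * 2 ^ K + real (fst d) - real (snd d)"

text \<open>Chosen so that the better option at each time gains exactly \<open>unit_cost\<close>.
  Nothing is credited at times congruent to 1, because a skip also collects the weight of the next
  time.\<close>

definition time_weight :: "nat \<Rightarrow> nat \<times> nat \<Rightarrow> nat \<Rightarrow> real" where
  "time_weight K d t =
     (if t mod 3 = 1 then 0 else unit_cost K d) - (if t mod 3 = 2 then 0 else max 0 (gain K d t))"

definition potential :: "nat \<Rightarrow> nat \<times> nat \<Rightarrow> point \<Rightarrow> real" where
  "potential K d = (\<lambda>(t, x, y).
     ((2 * 2 ^ K + real (fst d) + 1 / 2) * real y - real x + (\<Sum>i<t. time_weight K d i))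
     / unit_cost K d)"

lemma steps_iff_gain: "t mod 3 \<noteq> 2 \<Longrightarrow> steps K d t \<longleftrightarrow> gain K d t > 0"
  by (auto simp: steps_def gain_def)

text \<open>Parity: doubling the equation would equate an even and an odd number.\<close>

lemma gain_nonzero: "gain K d t \<noteq> 0"
proof
  assume "gain K d t = 0"
  then have "real (2 * bitrev K (t div 3)) = real (2 * (if t mod 3 = 0 then fst d else snd d) + 1)"
    by (simp add: gain_def field_simps)
  then show False by (metis of_nat_eq_iff dvd_triv_left odd_two_times_div_two_succ even_plus_one_iff)
qed

lemma less_power2_real: "k < 2 ^ K \<Longrightarrow> real k + 1 \<le> 2 ^ K"
proof -
  assume "k < 2 ^ K"
  then have "real (k + 1) \<le> real (2 ^ K)" by (subst of_nat_le_iff) simp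
  then show ?thesis by simp
qed

text \<open>Multiplied by \<open>unit_cost\<close>, the growth is
  \<open>\<gamma> - max 0 gain\<close> when staying or skipping and
  \<open>\<gamma> + gain - max 0 gain\<close> when moving, and just \<open>\<gamma>\<close> at times
  congruent to 2. As 0 < |gain| < \<open>\<gamma>\<close>, all values are positive and exactly one
  option attains \<open>\<gamma>\<close>. Positivity makes reversed arcs harmless in the undirected
  graph.\<close>

lemma grid_arc_potential:
  assumes d: "d \<in> {..<2 ^ K} \<times> {..<2 ^ K}" and uv: "grid_arc K u v"
  shows "0 < potential K d v - potential K d u" "potential K d v - potential K d u \<le> 1"
    "potential K d v - potential K d u = 1 \<longleftrightarrow> v = next_point K d u"
proof -
  define \<gamma> where "\<gamma> = unit_cost K d"
  have dK: "fst d < 2 ^ K" "snd d < 2 ^ K" using d by auto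
  then have dK': "real (fst d) + 1 \<le> 2 ^ K" "real (snd d) + 1 \<le> 2 ^ K"
    by (simp_all add: less_power2_real)
  then have \<gamma>: "\<gamma> > 2 ^ K" by (simp add: \<gamma>_def unit_cost_def)
  then have "\<gamma> > 0" by (smt (verit) zero_less_power)
  have gain_less: "\<bar>gain K d t\<bar> < \<gamma>" for t
  proof -
    have "real (bitrev K (t div 3)) + 1 \<le> 2 ^ K"
      by (rule less_power2_real[OF bitrev_less])
    then show ?thesis using \<gamma> dK' by (auto simp: gain_def abs_if)
  qed
  define \<delta> where "\<delta> = (potential K d v - potential K d u) * \<gamma>"
  have scaled: "potential K d (t, x, y) * \<gamma> =
      (2 * 2 ^ K + real (fst d) + 1 / 2) * real y - real x + (\<Sum>i<t. time_weight K d i)" for t x y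
    using \<open>\<gamma> > 0\<close> by (simp add: potential_def \<gamma>_def)
  have "0 < \<delta> \<and> \<delta> \<le> \<gamma> \<and> (\<delta> = \<gamma> \<longleftrightarrow> v = next_point K d u)"
    using uv
  proof cases
    case (stay t x y)
    then have "\<delta> = time_weight K d t"
      by (simp add: \<delta>_def left_diff_distrib scaled)
    then show ?thesis
      using stay gain_less[of t] gain_nonzero[of K d t] steps_iff_gain[of t K d] \<open>\<gamma> > 0\<close>
      by (auto simp: time_weight_def next_point_def \<gamma>_def[symmetric] steps_def)
  next
    case (skip t x y)
    then have "\<delta> = time_weight K d t + time_weight K d (Suc t)"
      by (simp add: \<delta>_def left_diff_distrib scaled)
    moreover have "Suc t mod 3 = 2" using skip by presburger
    ultimately show ?thesis
      using skip gain_less[of t] gain_nonzero[of K d t] steps_iff_gain[of t K d] \<open>\<gamma> > 0\<close>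
      by (auto simp: time_weight_def next_point_def \<gamma>_def[symmetric])
  next
    case (step t x y)
    then have "\<delta> = 2 * 2 ^ K + real (fst d) + 1 / 2 - real (shift K t) + time_weight K d t"
      by (simp add: \<delta>_def left_diff_distrib scaled) (simp add: algebra_simps)
    also have "\<dots> = \<gamma> + gain K d t - max 0 (gain K d t)"
      using step by (auto simp: shift_def time_weight_def gain_def \<gamma>_def unit_cost_def)
    finally show ?thesis
      using step gain_less[of t] gain_nonzero[of K d t] steps_iff_gain[of t K d] \<open>\<gamma> > 0\<close>
      by (auto simp: next_point_def)
  qed
  moreover have "potential K d v - potential K d u = \<delta> / \<gamma>"
    using \<open>\<gamma> > 0\<close> by (simp add: \<delta>_def)
  ultimately show "0 < potential K d v - potential K d u" "potential K d v - potential K d u \<le> 1"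
    "potential K d v - potential K d u = 1 \<longleftrightarrow> v = next_point K d u"
    using \<open>\<gamma> > 0\<close> by (simp, simp, simp) metis
qed

lemma grid_arc_next_point: "grid_arc K u (next_point K d u)"
proof -
  obtain t x y where u: "u = (t, x, y)" by (cases u)
  show ?thesis
  proof (cases "steps K d t")
    case True
    then have "t mod 3 \<noteq> 2" by (simp add: steps_def)
    then show ?thesis using True u by (simp add: next_point_def grid_arc.step[simplified])
  next
    case False
    then show ?thesis
      using u grid_arc.stay[of t K x y] grid_arc.skip[of t K x y] by (simp add: next_point_def)
  qed
qed

lemma next_point_time_le: "fst (next_point K d u) \<le> fst u + 2"
  by (auto simp: next_point_def split: prod.split)

text \<open>A common walk stops at every such time \<open>c\<close>, since a skip omits only a time
  congruent to 2. Whether its next arc raises the y-coordinate reveals the decision of both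
  directions.\<close>

lemma rtrancl_next_point_agree:
  assumes "(u, v) \<in> R\<^sup>*"
    and R: "\<And>u v. (u, v) \<in> R \<Longrightarrow> v = next_point K d u \<and> v = next_point K d' u"
    and "fst u \<le> c" "c < fst v" "c mod 3 \<noteq> 2"
  shows "steps K d c \<longleftrightarrow> steps K d' c"
  using assms(1,4)
proof (induction rule: rtrancl_induct)
  case base
  then show ?case using \<open>fst u \<le> c\<close> by simp
next
  case (step v w)
  show ?case
  proof (cases "c < fst v")
    case False
    obtain t x y where v: "v = (t, x, y)" by (cases v)
    have w: "w = next_point K d (t, x, y)" "w = next_point K d' (t, x, y)"
      using R[OF step(2)] v by auto
    have "c = t"
    proof (rule ccontr)
      assume "c \<noteq> t"
      then have "c = t + 1" "fst w = t + 2"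
        using False step.prems v w(1) next_point_time_le[of K d "(t, x, y)"] by auto
      moreover from this(2) have "t mod 3 = 1"
        using w(1) by (auto simp: next_point_def split: if_splits)
      ultimately have "c mod 3 = 2" by presburger
      then show False using \<open>c mod 3 \<noteq> 2\<close> by simp
    qed
    then show ?thesis using w by (auto simp: next_point_def split: if_splits)
  qed (use step in auto)
qed

section \<open>Closed form of the walk of a direction\<close>

definition travel_x :: "nat \<Rightarrow> nat \<times> nat \<Rightarrow> nat \<Rightarrow> nat" where
  "travel_x K d t = (\<Sum>i<t. if steps K d i then shift K i else 0)"

definition travel_y :: "nat \<Rightarrow> nat \<times> nat \<Rightarrow> nat \<Rightarrow> nat" where
  "travel_y K d t = (\<Sum>i<t. if steps K d i then 1 else 0)"

text \<open>Defined also at a time that a skip passes over; no move is ever made there, so the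
  position is simply repeated.\<close>

definition track :: "nat \<Rightarrow> nat \<times> nat \<Rightarrow> nat \<Rightarrow> nat \<Rightarrow> nat \<Rightarrow> point" where
  "track K d x y t = (t, x + travel_x K d t, y + travel_y K d t)"

lemma track_0 [simp]: "track K d x y 0 = (0, x, y)"
  by (simp add: track_def travel_x_def travel_y_def)

lemma shift_less: "shift K t < 3 * 2 ^ K"
  using bitrev_less[of K "t div 3"] by (simp add: shift_def)

lemma travel_x_le: "travel_x K d t \<le> 3 * 2 ^ K * t"
proof -
  have "travel_x K d t \<le> (\<Sum>i<t. 3 * 2 ^ K)"
    unfolding travel_x_def using shift_less by (intro sum_mono) (auto intro: less_imp_le)
  then show ?thesis by (simp add: mult.commute)
qed

lemma travel_y_le: "travel_y K d t \<le> t"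
proof -
  have "travel_y K d t \<le> (\<Sum>i<t. 1)"
    unfolding travel_y_def by (intro sum_mono) auto
  then show ?thesis by simp
qed

lemma not_steps_after_skip: "t mod 3 = 1 \<Longrightarrow> \<not> steps K d (Suc t)"
proof -
  assume "t mod 3 = 1"
  then have "Suc t mod 3 = 2" by presburger
  then show ?thesis by (simp add: steps_def)
qed

lemma next_point_track:
  "next_point K d (track K d x y t) = track K d x y (if t mod 3 = 1 \<and> \<not> steps K d t then t + 2 else t + 1)"
  using not_steps_after_skip[of t K d]
  by (auto simp: next_point_def track_def travel_x_def travel_y_def)

lemma track_unique:
  assumes "(u, v) \<in> R\<^sup>*" and R: "\<And>u v. (u, v) \<in> R \<Longrightarrow> v = next_point K d u"
    and "u = track K d x y t"
  shows "v = track K d x y (fst v)"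
  using assms(1)
proof (induction rule: rtrancl_induct)
  case base
  then show ?case using assms(3) by (simp add: track_def)
next
  case (step v w)
  then show ?case using R[OF step(2)] next_point_track[of K d x y "fst v"] by (simp add: track_def)
qed

text \<open>The induction runs over whole periods because multiples of 3 are always visited.
  \<open>R\<close> is only required to contain arcs that end by time \<open>3 * l\<close>, so it may
  be confined to the box.\<close>

lemma track_rtrancl:
  assumes R: "\<And>t. t < 3 * l \<Longrightarrow>
    fst (next_point K d (track K d x y t)) \<le> 3 * l \<Longrightarrow>
    (track K d x y t, next_point K d (track K d x y t)) \<in> R"
  shows "k \<le> l \<Longrightarrow> (track K d x y 0, track K d x y (3 * k)) \<in> R\<^sup>*"
proof (induction k)
  case (Suc k)
  let ?p = "track K d x y"
  have step: "(?p t, ?p (t + 1)) \<in> R" if "t + 1 \<le> 3 * l" "t mod 3 \<noteq> 1 \<or> steps K d t" for t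
  proof -
    have "next_point K d (?p t) = ?p (t + 1)" using that(2) unfolding next_point_track by auto
    then show ?thesis using R[of t] that(1) by (simp add: track_def)
  qed
  have skip: "(?p t, ?p (t + 2)) \<in> R" if "t + 2 \<le> 3 * l" "t mod 3 = 1" "\<not> steps K d t" for t
  proof -
    have "next_point K d (?p t) = ?p (t + 2)" using that(2,3) unfolding next_point_track by auto
    then show ?thesis using R[of t] that(1) by (simp add: track_def)
  qed
  have time: "3 * k + 3 \<le> 3 * l" using Suc.prems by simp
  have "(?p (3 * k), ?p (3 * k + 1)) \<in> R" using time by (intro step) auto
  moreover have "(?p (3 * k + 1), ?p (3 * k + 3)) \<in> R\<^sup>*"
  proof (cases "steps K d (3 * k + 1)")
    case True
    then have "(?p (3 * k + 1), ?p (3 * k + 1 + 1)) \<in> R" using time by (intro step) auto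
    moreover have "(3 * k + 2) mod 3 \<noteq> 1" by presburger
    then have "(?p (3 * k + 2), ?p (3 * k + 2 + 1)) \<in> R" using time by (intro step) auto
    moreover have "3 * k + 1 + 1 = 3 * k + 2" "3 * k + 2 + 1 = 3 * k + 3" by simp_all
    ultimately show ?thesis by (metis r_into_rtrancl rtrancl.rtrancl_into_rtrancl)
  next
    case False
    have "(3 * k + 1) mod 3 = 1" by presburger
    then have "(?p (3 * k + 1), ?p (3 * k + 1 + 2)) \<in> R" using time False by (intro skip) auto
    moreover have "3 * k + 1 + 2 = 3 * k + 3" by simp
    ultimately show ?thesis by (metis r_into_rtrancl)
  qed
  moreover have "(?p 0, ?p (3 * k)) \<in> R\<^sup>*" using Suc by simp
  ultimately have "(?p 0, ?p (3 * k + 3)) \<in> R\<^sup>*" by (meson rtrancl.rtrancl_into_rtrancl rtrancl_trans)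
  moreover have "3 * k + 3 = 3 * Suc k" by simp
  ultimately show ?case by metis
qed simp

section \<open>The grid as a graph on the natural numbers\<close>

text \<open>Both ranges are twice the largest displacement within time \<open>3 * l\<close>. A walk
  that starts in the lower halves therefore stays inside, whatever its direction.\<close>

definition box :: "nat \<Rightarrow> nat \<Rightarrow> point set" where
  "box K l = {..3 * l} \<times> {..<18 * 2 ^ K * l} \<times> {..<6 * l}"

definition directions :: "nat \<Rightarrow> (nat \<times> nat) set" where
  "directions K = {..<2 ^ K} \<times> {..<2 ^ K}"

locale grid_numbering =
  fixes K l N n :: nat and pt :: "nat \<Rightarrow> point"
  assumes pt: "bij_betw pt {..<N} (box K l)" and N_le: "N \<le> n"
begin

text \<open>The vertices from \<open>N\<close> up to \<open>n\<close> are isolated padding, which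
  makes every large vertex count available.\<close>

definition G :: "nat pair_pre_digraph" where
  "G = \<lparr>pverts = {..<n}, parcs = {(u, v). u < N \<and> v < N \<and>
     (grid_arc K (pt u) (pt v) \<or> grid_arc K (pt v) (pt u))}\<rparr>"

abbreviation T :: "nat \<times> nat \<Rightarrow> nat rel" where
  "T d \<equiv> tight G (\<lambda>u. potential K d (pt u))"

definition num :: "point \<Rightarrow> nat" where
  "num = inv_into {..<N} pt"

lemma num: "a \<in> box K l \<Longrightarrow> num a < N" "a \<in> box K l \<Longrightarrow> pt (num a) = a"
  "u < N \<Longrightarrow> num (pt u) = u"
  using pt inv_into_into[of _ pt "{..<N}"] f_inv_into_f[of _ pt "{..<N}"]
  by (auto simp: num_def bij_betw_def inv_into_f_f)

lemma pt_in_box: "u < N \<Longrightarrow> pt u \<in> box K l"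
  using pt by (auto simp: bij_betw_def)

lemma N_eq: "N = (3 * l + 1) * (18 * 2 ^ K * l * (6 * l))"
  using bij_betw_same_card[OF pt] by (simp add: box_def card_cartesian_product)

lemma grid_arc_time: "grid_arc K u v \<Longrightarrow> fst u < fst v"
  by (auto elim: grid_arc.cases)

lemma pair_graph_G: "pair_graph G"
proof
  show "finite (parcs G)"
    by (rule finite_subset[of _ "{..<N} \<times> {..<N}"]) (auto simp: G_def)
  show "symmetric G"
    unfolding symmetric_def by (auto simp: G_def sym_def)
qed (use N_le grid_arc_time in \<open>fastforce simp: G_def\<close>)+

sublocale pair_graph G
  by (rule pair_graph_G)

text \<open>Each edge is charged to its earlier end, from which at most two grid arcs leave.\<close>

lemma num_edges_G: "num_edges (parcs G) \<le> 2 * N"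
proof -
  define stay where "stay = (\<lambda>(t, x, y). if t mod 3 = 1 then (t + 2, x, y) else (t + 1, x, y) :: point)"
  define step where "step = (\<lambda>(t, x, y). (t + 1, x + shift K t, y + 1) :: point)"
  have arc: "b = stay a \<or> b = step a" if "grid_arc K a b" for a b
    using that by (auto elim!: grid_arc.cases simp: stay_def step_def)
  \<comment> \<open>Where a successor leaves the box, \<open>num\<close> is an arbitrary value; this
    only adds spurious pairs to the upper bound.\<close>
  let ?S = "(\<lambda>u. {u, num (stay (pt u))}) ` {..<N} \<union> (\<lambda>u. {u, num (step (pt u))}) ` {..<N}"
  have *: "{u, v} \<in> ?S" if "u < N" "v < N" "grid_arc K (pt u) (pt v)" for u v
    using arc[OF that(3)] that(1,2) num(3)[of v] by (auto intro!: imageI)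
  then have "(\<lambda>(u, v). {u, v}) ` parcs G \<subseteq> ?S"
  proof (intro image_subsetI)
    fix e assume "e \<in> parcs G"
    then obtain u v where e: "e = (u, v)" "u < N" "v < N"
      "grid_arc K (pt u) (pt v) \<or> grid_arc K (pt v) (pt u)"
      by (auto simp: G_def)
    then have "{u, v} \<in> ?S" using *[of u v] *[of v u] by (metis insert_commute)
    then show "(case e of (u, v) \<Rightarrow> {u, v}) \<in> ?S" using e(1) by simp
  qed
  then have "num_edges (parcs G) \<le> card ?S"
    unfolding num_edges_def by (intro card_mono) auto
  also have "\<dots> \<le> card ((\<lambda>u. {u, num (stay (pt u))}) ` {..<N}) + card ((\<lambda>u. {u, num (step (pt u))}) ` {..<N})"
    by (rule card_Un_le)
  also have "\<dots> \<le> N + N"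
    by (intro add_mono order_trans[OF card_image_le]) auto
  finally show ?thesis by simp
qed

lemma potential_lipschitz:
  assumes "d \<in> directions K" "(u, v) \<in> parcs G"
  shows "potential K d (pt v) - potential K d (pt u) \<le> 1"
proof -
  have "grid_arc K (pt u) (pt v) \<or> grid_arc K (pt v) (pt u)" using assms by (simp add: G_def)
  then show ?thesis
    using grid_arc_potential(1,2)[of d K "pt u" "pt v"] grid_arc_potential(1)[of d K "pt v" "pt u"]
      assms(1) by (auto simp: directions_def)
qed

lemma tight_G_iff:
  assumes "d \<in> directions K"
  shows "(u, v) \<in> T d \<longleftrightarrow> u < N \<and> v < N \<and> pt v = next_point K d (pt u)"
proof -
  have d: "d \<in> {..<2 ^ K} \<times> {..<2 ^ K}" using assms by (simp add: directions_def)
  show ?thesis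
    using grid_arc_potential[OF d, of "pt u" "pt v"] grid_arc_potential(1)[OF d, of "pt v" "pt u"]
      grid_arc_next_point[of K "pt u" d]
    by (auto simp: tight_iff G_def)
qed

section \<open>Directions served by a single hop\<close>

lemma tight_rtrancl_less:
  assumes "d \<in> directions K" "(u, v) \<in> (T d)\<^sup>*" "u \<noteq> v"
  shows "u < N" "v < N"
proof -
  obtain w where "(u, w) \<in> T d"
    using assms(2,3) by (metis converse_rtranclE)
  then show "u < N" using assms(1) by (simp add: tight_G_iff)
  obtain w where "(w, v) \<in> T d"
    using assms(2,3) by (metis rtranclE)
  then show "v < N" using assms(1) by (simp add: tight_G_iff)
qed

lemma pt_rtrancl:
  assumes "(u, v) \<in> S\<^sup>*"
  shows "(pt u, pt v) \<in> {(pt u, pt v) |u v. (u, v) \<in> S}\<^sup>*"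
  using assms
proof induction
  case (step v w)
  then have "(pt v, pt w) \<in> {(pt u, pt v) |u v. (u, v) \<in> S}" by blast
  with step.IH show ?case by (rule rtrancl_into_rtrancl)
qed simp

text \<open>All directions served by the hop share one walk, and the hop spans \<open>2 ^ j\<close>
  whole periods. They agree on the decisions at both moving times of these periods, so bit reversal
  confines each coordinate of the direction to \<open>2 * 2 ^ (K - j)\<close> values.\<close>

lemma few_directions:
  assumes "j \<le> K" and long: "fst (pt u) + 3 * 2 ^ j < fst (pt v)"
  shows "card {d \<in> directions K. (u, v) \<in> (T d)\<^sup>*} \<le> 4 * 4 ^ (K - j)"
proof -
  let ?D = "{d \<in> directions K. (u, v) \<in> (T d)\<^sup>*}"
  \<comment> \<open>The first period that starts no earlier than \<open>u\<close>: a third of the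
    time of \<open>u\<close>, rounded up.\<close>
  define m where "m = (fst (pt u) + 2) div 3"
  have "u \<noteq> v" using long by auto
  have agree: "steps K d c \<longleftrightarrow> steps K d' c"
    if d: "d \<in> ?D" "d' \<in> ?D" and c: "fst (pt u) \<le> c" "c < fst (pt v)" "c mod 3 \<noteq> 2" for d d' c
  proof -
    have "u \<in> pverts G" using tight_rtrancl_less(1)[of d u v] d \<open>u \<noteq> v\<close> N_le by (auto simp: G_def)
    then have "(u, v) \<in> (T d \<inter> T d')\<^sup>*"
      using d by (intro tight_rtrancl_Int) (auto intro: potential_lipschitz)
    from pt_rtrancl[OF this] _ c show ?thesis
      by (rule rtrancl_next_point_agree) (use d in \<open>auto simp: tight_G_iff\<close>)
  qed
  have window: "fst (pt u) \<le> 3 * i" "3 * i + 1 < fst (pt v)" if "m \<le> i" "i < m + 2 ^ j" for i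
    using that long unfolding m_def by linarith+
  have "card (fst ` ?D) \<le> 2 * 2 ^ (K - j)"
  proof (rule card_bitrev_indistinguishable[OF \<open>j \<le> K\<close>])
    fix p p' i assume *: "p \<in> fst ` ?D" "p' \<in> fst ` ?D" "m \<le> i" "i < m + 2 ^ j"
    then obtain d d' where d: "d \<in> ?D" "p = fst d" "d' \<in> ?D" "p' = fst d'" by blast
    then show "bitrev K i \<le> p \<longleftrightarrow> bitrev K i \<le> p'"
      using agree[OF d(1,3), of "3 * i"] window[OF *(3,4)] by (simp add: steps_def)
  qed (auto simp: directions_def)
  moreover have "card (snd ` ?D) \<le> 2 * 2 ^ (K - j)"
  proof (rule card_bitrev_indistinguishable[OF \<open>j \<le> K\<close>])
    fix p p' i assume *: "p \<in> snd ` ?D" "p' \<in> snd ` ?D" "m \<le> i" "i < m + 2 ^ j"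
    then obtain d d' where d: "d \<in> ?D" "p = snd d" "d' \<in> ?D" "p' = snd d'" by blast
    have "(3 * i + 1) mod 3 = 1" "(3 * i + 1) div 3 = i" by presburger+
    then show "bitrev K i \<le> p \<longleftrightarrow> bitrev K i \<le> p'"
      using agree[OF d(1,3), of "3 * i + 1"] window[OF *(3,4)] d by (simp add: steps_def)
  qed (auto simp: directions_def)
  ultimately have "card (fst ` ?D) * card (snd ` ?D) \<le> (2 * 2 ^ (K - j)) * (2 * 2 ^ (K - j))"
    by (rule mult_le_mono)
  also have "\<dots> = 4 * 4 ^ (K - j)" by (simp flip: power_mult_distrib)
  finally have "card (fst ` ?D \<times> snd ` ?D) \<le> 4 * 4 ^ (K - j)" by (simp add: card_cartesian_product)
  moreover have "finite ?D" by (simp add: directions_def)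
  then have "card ?D \<le> card (fst ` ?D \<times> snd ` ?D)"
    by (intro card_mono finite_cartesian_product finite_imageI subsetI) (auto simp: mem_Times_iff)
  ultimately show ?thesis by linarith
qed

section \<open>Critical walks and the counting argument\<close>

lemma track_in_box:
  assumes "x < 9 * 2 ^ K * l" "y < 3 * l" "t \<le> 3 * l"
  shows "track K d x y t \<in> box K l"
proof -
  have "travel_x K d t \<le> 3 * 2 ^ K * (3 * l)"
    using assms(3) by (intro order_trans[OF travel_x_le] mult_le_mono2)
  moreover have "travel_y K d t \<le> 3 * l"
    using travel_y_le[of K d t] assms(3) by simp
  ultimately show ?thesis using assms by (simp add: track_def box_def)
qed

lemma critical_path:
  assumes d: "d \<in> directions K" and "x < 9 * 2 ^ K * l" "y < 3 * l"
  shows "(num (track K d x y 0), num (track K d x y (3 * l))) \<in> (T d)\<^sup>*"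
proof -
  let ?R = "{(a, b). a \<in> box K l \<and> b \<in> box K l \<and> b = next_point K d a}"
  have "(track K d x y 0, track K d x y (3 * l)) \<in> ?R\<^sup>*"
  proof (rule track_rtrancl)
    fix t assume t: "t < 3 * l" "fst (next_point K d (track K d x y t)) \<le> 3 * l"
    have "track K d x y t \<in> box K l" using t(1) by (intro track_in_box assms(2,3)) simp
    moreover have "next_point K d (track K d x y t) \<in> box K l"
      using t(2) unfolding next_point_track by (intro track_in_box assms(2,3)) (simp add: track_def)
    ultimately show "(track K d x y t, next_point K d (track K d x y t)) \<in> ?R" by simp
  qed simp
  then show ?thesis
  proof (induction rule: rtrancl_induct)
    case (step a b)
    then have "a \<in> box K l" "b \<in> box K l" "b = next_point K d a" by auto
    then have "(num a, num b) \<in> T d" using d num(1,2)[of a] num(1,2)[of b] by (simp add: tight_G_iff)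
    with step.IH show ?case by simp
  qed simp
qed


lemma few_directions_long_hop:
  assumes l: "l = 4 ^ (K - (e + 2))" and K: "e + 2 \<le> K"
    and long: "3 * 2 ^ (2 * e + 5) + 1 \<le> real (fst (pt v)) - real (fst (pt u))"
  shows "(real (fst (pt v)) - real (fst (pt u))) * real (card {d \<in> directions K. (u, v) \<in> (T d)\<^sup>*})
    \<le> 4 ^ K / 4 ^ e"
proof (cases "{d \<in> directions K. (u, v) \<in> (T d)\<^sup>*} = {}")
  case True
  then show ?thesis by (simp only: card.empty) simp
next
  case False
  define len where "len = fst (pt v) - fst (pt u)"
  have lt: "fst (pt u) < fst (pt v)" using long by (smt (verit) of_nat_less_iff zero_le_power)
  then have len: "real (fst (pt v)) - real (fst (pt u)) = real len" by (simp add: len_def)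
  have "real (3 * 2 ^ (2 * e + 5) + 1) \<le> real len" using long len by simp
  then have long': "3 * 2 ^ (2 * e + 5) < len" by linarith
  have "v < N" using False lt tight_rtrancl_less(2) by blast
  then have "fst (pt v) \<le> 3 * l" using pt_in_box[of v] by (auto simp: box_def)
  then have "len \<le> 3 * l" by (simp add: len_def)
  have "real len * real (card {d \<in> directions K. (u, v) \<in> (T d)\<^sup>*}) \<le> 4 ^ K / 4 ^ e"
  \<comment> \<open>A hop spanning \<open>2 ^ K\<close> periods serves at most 4 directions, and its
    length is bounded only by the total time \<open>3 * l\<close>. This is where \<open>l\<close>
    must be a small multiple of \<open>4 ^ K\<close>.\<close>
  proof (cases "3 * 2 ^ K < len")
    case True
    have "card {d \<in> directions K. (u, v) \<in> (T d)\<^sup>*} \<le> 4 * 4 ^ (K - K)"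
      by (rule few_directions) (use True len_def in auto)
    with \<open>len \<le> 3 * l\<close> have "len * card {d \<in> directions K. (u, v) \<in> (T d)\<^sup>*} \<le> (3 * l) * 4"
      by (intro mult_le_mono) auto
    then have "real (len * card {d \<in> directions K. (u, v) \<in> (T d)\<^sup>*}) \<le> real ((3 * l) * 4)"
      by (rule of_nat_mono)
    then have "real len * real (card {d \<in> directions K. (u, v) \<in> (T d)\<^sup>*}) \<le> 12 * 4 ^ (K - (e + 2))"
      by (simp add: l)
    also have "\<dots> \<le> 4 ^ K / 4 ^ e"
      using K by (simp add: power_diff power_add field_simps)
    finally show ?thesis .
  next
    case False
    \<comment> \<open>The dyadic scale with 3 * 2^j < len <= 6 * 2^j. The product is then at most 24
      * 4^K / 2^j, and the threshold \<open>2 * e + 5\<close> ensures 2^j >= 32 * 4^e, so 24/32 of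
      the claimed bound remains.\<close>
    define j where "j = (LEAST j. len \<le> 3 * 2 ^ Suc j)"
    have ex: "len \<le> 3 * 2 ^ Suc K" using False by simp
    then have j1: "len \<le> 3 * 2 ^ Suc j" unfolding j_def by (rule LeastI)
    have j2: "3 * 2 ^ j < len"
    proof (cases j)
      case 0
      have "(2::nat) ^ (2 * e + 5) \<ge> 1" by simp
      then have "3 < len" using long' by linarith
      then show ?thesis using 0 by simp
    next
      case (Suc i)
      then show ?thesis using not_less_Least[of i "\<lambda>j. len \<le> 3 * 2 ^ Suc j"] by (simp add: j_def)
    qed
    have "(2::nat) ^ (2 * e + 5) < 2 ^ Suc j" using long' j1 by linarith
    then have "2 * e + 5 < Suc j" by (rule power_less_imp_less_exp[rotated]) simp
    then have "(2::real) ^ (2 * e + 5) \<le> 2 ^ j" by (intro power_increasing) auto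
    then have j3: "32 * (4::real) ^ e \<le> 2 ^ j" by (simp add: power_add power_mult)
    have "(2::nat) ^ j < 2 ^ K" using j2 False by linarith
    then have "j \<le> K" by (simp add: less_imp_le)
    then have "card {d \<in> directions K. (u, v) \<in> (T d)\<^sup>*} \<le> 4 * 4 ^ (K - j)"
      by (rule few_directions) (use j2 len_def in auto)
    with j1 have "len * card {d \<in> directions K. (u, v) \<in> (T d)\<^sup>*} \<le> (3 * 2 ^ Suc j) * (4 * 4 ^ (K - j))"
      by (rule mult_le_mono)
    then have "real (len * card {d \<in> directions K. (u, v) \<in> (T d)\<^sup>*})
        \<le> real ((3 * 2 ^ Suc j) * (4 * 4 ^ (K - j)))"
      by (rule of_nat_mono)
    then have "real len * real (card {d \<in> directions K. (u, v) \<in> (T d)\<^sup>*}) \<le> 24 * 2 ^ j * 4 ^ (K - j)"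
      by simp
    also have "\<dots> = 24 * 4 ^ K / 2 ^ j"
    proof -
      have "(4::real) ^ K = 4 ^ j * 4 ^ (K - j)" using \<open>j \<le> K\<close> by (simp flip: power_add)
      also have "(4::real) ^ j = 2 ^ j * 2 ^ j" by (simp flip: power_mult_distrib)
      finally show ?thesis by simp
    qed
    also have "\<dots> \<le> 24 * 4 ^ K / (32 * 4 ^ e)"
      using j3 by (intro divide_left_mono) auto
    also have "\<dots> \<le> 4 ^ K / 4 ^ e" by (simp add: field_simps)
    finally show ?thesis .
  qed
  then show ?thesis by (simp only: len)
qed

text \<open>With too few hops the charging bound applies to all starts in the lower halves of the
  box and all directions. It contradicts the linear number of edges, since \<open>e\<close> absorbs
  the constant \<open>C\<close>.\<close>

lemma hops_suffice_lower_bound: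
  assumes l: "l = 4 ^ (K - (e + 2))" and K: "e + 2 \<le> K" and C: "0 < C" "24 * C \<le> 4 ^ e"
    and H: "exact_hopset G H" "real (num_edges H) \<le> C * real (num_edges (parcs G))"
    and hops: "hops_suffice G H \<beta>"
  shows "3 * real l / 2 < real \<beta> * (3 * 2 ^ (2 * e + 5) + 1)"
proof (rule ccontr)
  assume "\<not> ?thesis"
  then have short: "real \<beta> * (3 * 2 ^ (2 * e + 5) + 1) \<le> 3 * real l / 2" by simp
  define X where "X = {..<9 * 2 ^ K * l} \<times> {..<3 * l} \<times> directions K"
  define ends where "ends = (\<lambda>(x, y, d). (num (track K d x y 0), num (track K d x y (3 * l)), d))"
  have l_pos: "0 < l" by (simp add: l)
  have box_start: "track K d x y t \<in> box K l" if "(x, y, d) \<in> X" "t \<le> 3 * l" for x y d t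
    using that by (intro track_in_box) (auto simp: X_def)
  have "inj_on ends X"
  proof (rule inj_onI)
    fix a b assume ab: "a \<in> X" "b \<in> X" "ends a = ends b"
    obtain x y d x' y' d' where [simp]: "a = (x, y, d)" "b = (x', y', d')" by (cases a, cases b)
    have eq: "num (track K d x y 0) = num (track K d' x' y' 0)" "d = d'"
      using ab(3) by (auto simp: ends_def)
    have X: "(x, y, d) \<in> X" "(x', y', d') \<in> X" using ab by auto
    have "track K d x y 0 = pt (num (track K d x y 0))"
      by (rule num(2)[OF box_start[OF X(1)], symmetric]) simp
    also have "\<dots> = pt (num (track K d' x' y' 0))" by (simp only: eq(1))
    also have "\<dots> = track K d' x' y' 0" by (rule num(2)[OF box_start[OF X(2)]]) simp
    finally show "a = b" using eq(2) by simp
  qed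
  then have "card (ends ` X) = 9 * 2 ^ K * l * (3 * l * (2 ^ K * 2 ^ K))"
    by (simp add: card_image X_def card_cartesian_product directions_def)
  then have card_P: "real (card (ends ` X)) = 27 * 2 ^ K * real l ^ 2 * 4 ^ K"
    by (simp add: power2_eq_square flip: power_mult_distrib)
  have "real (card (ends ` X)) * (3 * real l) \<le> 2 * (4 ^ K / 4 ^ e) * real (num_edges H)"
  proof (rule exact_hopset_charging[where D = "directions K" and \<tau> = "\<lambda>u. fst (pt u)"
        and L = "3 * 2 ^ (2 * e + 5) + 1" and \<beta> = \<beta> and \<phi> = "\<lambda>d u. potential K d (pt u)"])
    fix d u v assume "d \<in> directions K" "(u, v) \<in> T d"
    then have "real (fst (pt v)) - real (fst (pt u)) \<le> 2"
      using next_point_time_le[of K d "pt u"] by (simp add: tight_G_iff)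
    then show "real (fst (pt v)) - real (fst (pt u)) < 3 * 2 ^ (2 * e + 5) + 1"
      using one_le_power[of "2::real" "2 * e + 5"] by linarith
  next
    fix s t d assume "(s, t, d) \<in> ends ` X"
    then obtain x y where X: "(x, y, d) \<in> X"
      and st: "s = num (track K d x y 0)" "t = num (track K d x y (3 * l))"
      by (auto simp: ends_def)
    have d: "d \<in> directions K" using X by (simp add: X_def)
    have "pt s = track K d x y 0" "s < N"
      using num(1,2)[OF box_start[OF X, of 0]] st by auto
    moreover have "pt t = track K d x y (3 * l)" using num(2)[OF box_start[OF X, of "3 * l"]] st by auto
    moreover have "(s, t) \<in> (T d)\<^sup>*"
      unfolding st using X by (intro critical_path) (auto simp: X_def)
    ultimately show "d \<in> directions K \<and> s \<in> pverts G \<and> (s, t) \<in> (T d)\<^sup>* \<and>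
        real (fst (pt t)) - real (fst (pt s)) = 3 * real l"
      using d N_le by (auto simp: G_def track_def)
  next
    fix s t s' t' d u
    assume *: "(s, t, d) \<in> ends ` X" "(s', t', d) \<in> ends ` X" "(s, u) \<in> (T d)\<^sup>*" "(s', u) \<in> (T d)\<^sup>*"
    obtain x y x' y' where X: "(x, y, d) \<in> X" "(x', y', d) \<in> X"
      and st: "s = num (track K d x y 0)" "t = num (track K d x y (3 * l))"
        "s' = num (track K d x' y' 0)" "t' = num (track K d x' y' (3 * l))"
      using *(1,2) by (auto simp: ends_def)
    have d: "d \<in> directions K" using X by (simp add: X_def)
    have "pt s = track K d x y 0" "pt s' = track K d x' y' 0"
      using num(2)[OF box_start[OF X(1), of 0]] num(2)[OF box_start[OF X(2), of 0]] st by auto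
    then have "pt u = track K d x y (fst (pt u))" "pt u = track K d x' y' (fst (pt u))"
      using track_unique[OF pt_rtrancl[OF *(3)], of K d x y 0]
        track_unique[OF pt_rtrancl[OF *(4)], of K d x' y' 0] d by (force simp: tight_G_iff)+
    then have "track K d x y (fst (pt u)) = track K d x' y' (fst (pt u))" by metis
    \<comment> \<open>Walks of the same direction are translates of each other, so a common point
      forces a common start.\<close>
    then have "x = x'" "y = y'" by (auto simp: track_def)
    then show "s = s' \<and> t = t'" using st by simp
  next
    fix u v assume "3 * 2 ^ (2 * e + 5) + 1 \<le> real (fst (pt v)) - real (fst (pt u))"
    then show "(real (fst (pt v)) - real (fst (pt u))) *
        real (card {d \<in> directions K. (u, v) \<in> (T d)\<^sup>*}) \<le> 4 ^ K / 4 ^ e"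
      by (rule few_directions_long_hop[OF l K])
  next
    show "(0::real) < 3 * 2 ^ (2 * e + 5) + 1" by (intro add_pos_pos) auto
    show "finite (directions K)" "finite (ends ` X)" by (simp_all add: X_def directions_def)
  next
    fix d u v assume "d \<in> directions K" "(u, v) \<in> parcs G"
    then show "potential K d (pt v) - potential K d (pt u) \<le> 1" by (rule potential_lipschitz)
  next
    show "pair_graph G" by (rule pair_graph_G)
    show "exact_hopset G H" "hops_suffice G H \<beta>" by fact+
    show "real \<beta> * (3 * 2 ^ (2 * e + 5) + 1) \<le> 3 * real l / 2" by fact
    show "(0::real) \<le> 4 ^ K / 4 ^ e" by simp
  qed
  also have "\<dots> \<le> 2 * (4 ^ K / 4 ^ e) * (C * real (2 * N))"
  proof -
    have "real (num_edges H) \<le> C * real (2 * N)"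
      using H(2) by (rule order_trans)
        (use C(1) in \<open>intro mult_left_mono of_nat_mono num_edges_G\<close>, simp)
    then show ?thesis by (intro mult_left_mono) auto
  qed
  also have "\<dots> \<le> 2 * (4 ^ K / 4 ^ e) * (C * (864 * 2 ^ K * real l ^ 3))"
  proof -
    have "N \<le> 4 * l * (18 * 2 ^ K * l * (6 * l))"
      unfolding N_eq using l_pos by (intro mult_le_mono1) simp
    then have "real (2 * N) \<le> real (2 * (4 * l * (18 * 2 ^ K * l * (6 * l))))"
      by (intro of_nat_mono mult_le_mono2)
    also have "\<dots> = 864 * 2 ^ K * real l ^ 3" by (simp add: power3_eq_cube)
    finally show ?thesis using C(1) by (intro mult_left_mono) auto
  qed
  \<comment> \<open>The left-hand side of the chain is 27 * 3 = 81 times the same product, so 72 <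
    81 gives the contradiction.\<close>
  also have "\<dots> = 72 * (24 * C / 4 ^ e) * (4 ^ K * 2 ^ K * real l ^ 3)" by simp
  also have "\<dots> \<le> 72 * 1 * (4 ^ K * 2 ^ K * real l ^ 3)"
    using C(2) by (intro mult_right_mono mult_left_mono) (auto simp: divide_simps)
  also have "\<dots> < 81 * (4 ^ K * 2 ^ K * real l ^ 3)" using l_pos by simp
  finally show False unfolding card_P by (simp add: power2_eq_square power3_eq_cube)
qed

end

section \<open>Choice of the parameters for a given number of vertices\<close>

theorem theorem9p1:
  fixes C :: real
  assumes "C > 0"
  shows "\<exists>c::real. c > 0 \<and> (\<exists>n\<^sub>0::nat. \<forall>n\<ge>n\<^sub>0.
           \<exists>(G :: nat pair_pre_digraph) m::nat.
             pair_graph G \<and> card (pverts G) = n \<and> num_edges (parcs G) = m \<and>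
             (\<forall>H. exact_hopset G H \<and> real (num_edges H) \<le> C * real m \<longrightarrow>
                  real (hopbound G H) \<ge> c * real n powr (2/7)))"
proof -
  obtain e where e: "24 * C < 4 ^ e"
    using real_arch_pow[of 4 "24 * C"] by auto
  define a where "a = e + 2"
  define L :: real where "L = 3 * 2 ^ (2 * e + 5) + 1"
  have "L > 0" by (simp add: L_def add_pos_pos)
  \<comment> \<open>Chosen so that \<open>c * 4 ^ (K + 1)\<close> equals
    \<open>3 * l / (2 * L)\<close>, the bound on the number of hops.\<close>
  define c where "c = 3 / (2 * L * 4 ^ (a + 1))"
  have "c > 0" using \<open>L > 0\<close> by (simp add: c_def)
  have "\<exists>(G :: nat pair_pre_digraph) m::nat.
      pair_graph G \<and> card (pverts G) = n \<and> num_edges (parcs G) = m \<and>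
      (\<forall>H. exact_hopset G H \<and> real (num_edges H) \<le> C * real m \<longrightarrow>
        real (hopbound G H) \<ge> c * real n powr (2/7))" if n: "n \<ge> 128 ^ a" for n
  proof -
    have "n \<ge> 1" using n one_le_power[of "128::nat" a] by linarith
    \<comment> \<open>As 128 = 2^7, n is of order (2^K)^7 and \<open>n powr (2/7)\<close> is at most
      \<open>4 ^ (K + 1)\<close>. The assumption \<open>n \<ge> 128 ^ a\<close> gives
      \<open>a \<le> K\<close>, so \<open>K - a\<close> is not truncated.\<close>
    then obtain K where K: "128 ^ K \<le> n" "n < 128 ^ (K + 1)"
      using ex_power_ivl1[of 128 n] by auto
    have "(128::nat) ^ a < 128 ^ (K + 1)" using n K(2) by linarith
    then have "a < K + 1" by (rule power_less_imp_less_exp[rotated]) simp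
    then have aK: "a \<le> K" by simp
    define l :: nat where "l = 4 ^ (K - a)"
    define N where "N = card (box K l)"
    have "N \<le> 128 ^ K"
    proof -
      have "N = (3 * l + 1) * (18 * 2 ^ K * l * (6 * l))"
        by (simp add: N_def box_def card_cartesian_product)
      also have "\<dots> \<le> (4 * l) * (18 * 2 ^ K * l * (6 * l))"
        by (intro mult_le_mono1) (simp add: l_def)
      also have "\<dots> = 432 * 2 ^ K * l ^ 3" by (simp add: power3_eq_cube)
      \<comment> \<open>The constant 432 is below 16^3, and the factor 16 is available because
        \<open>a\<close> is at least 2.\<close>
      also have "\<dots> \<le> 2 ^ K * (4 ^ 2 * l) ^ 3" by (simp add: power_mult_distrib)
      also have "\<dots> \<le> 2 ^ K * (4 ^ K) ^ 3"
      proof -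
        have "(4::nat) ^ 2 * l = 4 ^ (2 + (K - a))" by (simp add: l_def power_add)
        also have "\<dots> \<le> 4 ^ K" using aK by (intro power_increasing) (auto simp: a_def)
        finally show ?thesis by (intro mult_le_mono2 power_mono) auto
      qed
      also have "\<dots> = (2 * 4 ^ 3) ^ K"
        by (simp only: power_mult_distrib power_mult[symmetric] mult.commute)
      finally show ?thesis by simp
    qed
    obtain pt where "bij_betw pt {..<N} (box K l)"
      using ex_bij_betw_nat_finite[of "box K l"]
      by (auto simp: N_def box_def atLeast0LessThan)
    then interpret grid_numbering K l N n pt
      using \<open>N \<le> 128 ^ K\<close> K(1) by unfold_locales auto
    have "c * real n powr (2/7) \<le> real (hopbound G H)"
      if H: "exact_hopset G H" "real (num_edges H) \<le> C * real (num_edges (parcs G))" for H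
    proof -
      have "hops_suffice G H (hopbound G H)"
        unfolding hopbound_def by (rule LeastI, rule hops_suffice_card[OF pair_graph_G H(1)])
      then have "3 * real l / 2 < real (hopbound G H) * L"
        unfolding L_def using aK e assms H
        by (intro hops_suffice_lower_bound[of e C H]) (auto simp: l_def a_def)
      then have bound: "3 * real l / (2 * L) < real (hopbound G H)"
        using \<open>L > 0\<close> by (simp add: field_simps)
      have "real n \<le> real (128 ^ (K + 1))" using K(2) by (intro of_nat_mono less_imp_le)
      then have "real n powr (2/7) \<le> real (128 ^ (K + 1)) powr (2/7)" by (intro powr_mono2) auto
      also have "real (128 ^ (K + 1)) = 2 ^ (7 * (K + 1))" by (simp only: power_mult) simp
      also have "\<dots> = 2 powr real (7 * (K + 1))" by (rule powr_realpow[symmetric]) simp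
      also have "\<dots> powr (2/7) = 2 powr (real (7 * (K + 1)) * (2/7))" by (rule powr_powr)
      also have "real (7 * (K + 1)) * (2/7) = real (2 * (K + 1))" by simp
      also have "2 powr real (2 * (K + 1)) = 2 ^ (2 * (K + 1))" by (rule powr_realpow) simp
      also have "\<dots> = (4::real) ^ (K + 1)" by (simp only: power_mult) simp
      finally have "c * real n powr (2/7) \<le> c * 4 ^ (K + 1)"
        using \<open>c > 0\<close> by (intro mult_left_mono) auto
      also have "\<dots> = 3 * real l / (2 * L)"
      proof -
        have "real l = 4 ^ K / 4 ^ a"
          unfolding l_def of_nat_power using aK by (simp add: power_diff)
        then show ?thesis by (simp add: c_def)
      qed
      finally show ?thesis using bound by linarith
    qed
    then show ?thesis
      using pair_graph_G by (intro exI[of _ G]) (auto simp: G_def)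
  qed
  then show ?thesis using \<open>c > 0\<close> by blast
qed

end
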